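(* For every $t\in\mathbb{C}\setminus\{0\}$, every integer $m\ge 0$, and either choice of sign (the same throughout), $$\left.\frac{\partial K_{\nu}(t)}{\partial\nu}\right|_{\nu=\pm m}=\pm\frac{m!}{2}\sum_{k=0}^{m-1}\frac{K_{k}(t)}{k!\,(m-k)}\left(\frac{t}{2}\right)^{k-m}.$$
   Context: $I_\nu(t)=\sum_{k=0}^{\infty}\frac{1}{k!\,\Gamma(k+\nu+1)}\left(\frac{t}{2}\right)^{2k+\nu}$ is the modified Bessel function of the first kind (principal branch, $-\pi<\arg t\le\pi$; $1/\Gamma$ is zero at the poles of $\Gamma$), and $K_\nu(t)=\frac{\pi}{2}\,\frac{I_{-\nu}(t)-I_\nu(t)}{\sin\pi\nu}$ (for integer $\nu$, the limit in $\nu$) is the modified Bessel function of the second kind. Empty sums are $0$. *)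

theory Defs
  imports "HOL-Analysis.Analysis"
begin

text \<open>
  Modified Bessel functions of complex order \<open>\<nu>\<close> and complex argument \<open>t\<close>. The library's
  complex \<open>powr\<close> is \<open>exp (w * Ln z)\<close> with \<open>-pi < Im (Ln z) \<le> pi\<close>, i.e. the principal branch,
  and \<open>rGamma\<close> is the entire function \<open>1/\<Gamma>\<close>. Since \<open>0 powr w = 0\<close> for all \<open>w\<close>, the
  definitions are only meaningful for \<open>t \<noteq> 0\<close>.
\<close>

definition bessel_I :: "complex \<Rightarrow> complex \<Rightarrow> complex" where
  "bessel_I \<nu> t =
     (\<Sum>k. rGamma (of_nat k + \<nu> + 1) / fact k * (t / 2) powr (2 * of_nat k + \<nu>))"

definition bessel_K_quotient :: "complex \<Rightarrow> complex \<Rightarrow> complex" where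
  "bessel_K_quotient \<nu> t =
     of_real pi / 2 * ((bessel_I (- \<nu>) t - bessel_I \<nu> t) / sin (of_real pi * \<nu>))"

definition bessel_K :: "complex \<Rightarrow> complex \<Rightarrow> complex" where
  "bessel_K \<nu> t =
     (if \<nu> \<in> \<int> then Lim (at \<nu>) (\<lambda>\<mu>. bessel_K_quotient \<mu> t) else bessel_K_quotient \<nu> t)"

end

theory Submission
  imports Defs "HOL-Complex_Analysis.Complex_Analysis"
begin

text \<open>
  For fixed \<open>t \<noteq> 0\<close> the series for \<open>I\<^sub>\<nu>(t)\<close> converges locally uniformly in \<open>\<nu>\<close>, and
  \<open>I\<^sub>-\<^sub>n = I\<^sub>n\<close> for integers \<open>n\<close>, so the singularities of the quotient defining \<open>K\<^sub>\<nu>(t)\<close> are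
  removable and \<open>K\<close> is an even entire function of \<open>\<nu>\<close>. Differentiating
  \<open>K\<^sub>\<nu>\<^sub>+\<^sub>1 = K\<^sub>\<nu>\<^sub>-\<^sub>1 + (2\<nu>/t) K\<^sub>\<nu>\<close> in \<open>\<nu>\<close> gives a two-step recurrence for the order
  derivatives at the integers. Evenness makes the derivative odd in \<open>\<nu>\<close>, which yields the
  initial values at \<open>0\<close> and \<open>1\<close>; the finite sum obeys the same recurrence.
\<close>

section \<open>Locally uniform convergence and holomorphy of the series in the order\<close>

definition bessel_I_term :: "complex \<Rightarrow> complex \<Rightarrow> nat \<Rightarrow> complex" where
  "bessel_I_term \<nu> t k = rGamma (of_nat k + \<nu> + 1) / fact k * (t / 2) powr (2 * of_nat k + \<nu>)"

lemma bessel_I_eq_suminf: "bessel_I \<nu> t = suminf (bessel_I_term \<nu> t)"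
  unfolding bessel_I_def bessel_I_term_def ..

text \<open>Only \<open>(t / 2) powr \<nu>\<close> remains as a complex power, and it does not
  depend on \<open>k\<close>. The split is valid on the principal branch because both exponents
  share one base, hence one logarithm.\<close>

lemma bessel_I_term_eq:
  assumes "t \<noteq> 0"
  shows "bessel_I_term \<nu> t k =
    rGamma (of_nat k + \<nu> + 1) / fact k * (t / 2) ^ (2 * k) * (t / 2) powr \<nu>"
proof -
  have "(t / 2) powr (2 * of_nat k + \<nu>) = (t / 2) powr (of_nat (2 * k)) * (t / 2) powr \<nu>"
    by (simp add: powr_def exp_add ring_distribs)
  also have "(t / 2) powr (of_nat (2 * k)) = (t / 2) ^ (2 * k)"
    using assms by (intro powr_nat') auto
  finally show ?thesis
    by (simp add: bessel_I_term_def)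
qed

text \<open>By \<open>rGamma z = z * rGamma (z + 1)\<close>, raising \<open>k\<close> by one divides
  the norm by that of \<open>of_nat k + \<nu> + 1\<close>, which is at least 1 once \<open>k\<close>
  is at least \<open>R\<close>. A bound at one such index, supplied by compactness of the disc,
  serves all later ones.\<close>

lemma rGamma_shift_bounded:
  fixes R :: real
  obtains M where "0 \<le> M"
    "\<forall>\<^sub>F k in sequentially. \<forall>\<nu>\<in>cball (0::complex) R. norm (rGamma (of_nat k + \<nu> + 1)) \<le> M"
proof -
  obtain N :: nat where N: "R \<le> real N"
    using real_arch_simple by blast
  have "compact ((\<lambda>\<nu>::complex. rGamma (of_nat N + \<nu> + 1)) ` cball 0 R)"
    by (intro compact_continuous_image holomorphic_on_imp_continuous_on holomorphic_intros) auto
  then obtain M0 where M0: "\<And>\<nu>. \<nu> \<in> cball (0::complex) R \<Longrightarrow> norm (rGamma (of_nat N + \<nu> + 1)) \<le> M0"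
    by (meson compact_imp_bounded bounded_iff image_eqI)
  define M where "M = max 0 M0"
  have bound: "norm (rGamma (of_nat k + \<nu> + 1)) \<le> M" if "N \<le> k" "\<nu> \<in> cball 0 R" for k and \<nu> :: complex
    using that(1)
  proof (induction k rule: dec_induct)
    case base
    show ?case using M0[OF that(2)] by (simp add: M_def)
  next
    case (step k)
    have "real k + 1 - norm \<nu> \<le> norm (of_nat k + \<nu> + 1)"
    proof -
      have "norm (of_nat (Suc k) :: complex) - norm (- \<nu>) \<le> norm (of_nat (Suc k) - (- \<nu>))"
        by (rule norm_triangle_ineq2)
      then show ?thesis by (simp add: add_ac del: of_nat_Suc) (simp add: add_ac)
    qed
    then have ge1: "1 \<le> norm (of_nat k + \<nu> + 1)"
      using N step(1) that(2) by simp
    have "norm (rGamma (of_nat (Suc k) + \<nu> + 1)) \<le>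
          norm (of_nat k + \<nu> + 1) * norm (rGamma (of_nat (Suc k) + \<nu> + 1))"
      using mult_right_mono[OF ge1 norm_ge_zero] by simp
    also have "\<dots> = norm (rGamma (of_nat k + \<nu> + 1))"
      using rGamma_plus1[of "of_nat k + \<nu> + 1"] by (simp add: norm_mult[symmetric] add_ac)
    finally show ?case using step.IH by simp
  qed
  show ?thesis
  proof (rule that[of M])
    show "0 \<le> M" by (simp add: M_def)
    show "\<forall>\<^sub>F k in sequentially. \<forall>\<nu>\<in>cball (0::complex) R. norm (rGamma (of_nat k + \<nu> + 1)) \<le> M"
      using eventually_ge_at_top[of N] by eventually_elim (use bound in blast)
  qed
qed

text \<open>On the disc the \<open>rGamma\<close> factors are eventually bounded and
  \<open>(t / 2) powr \<nu>\<close> is bounded, so a multiple of an exponential series is a majorant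
  for the Weierstrass M-test.\<close>

lemma uniform_limit_bessel_I:
  assumes "t \<noteq> 0"
  shows "uniform_limit (cball 0 R) (\<lambda>n \<nu>. \<Sum>k<n. bessel_I_term \<nu> t k)
    (\<lambda>\<nu>. bessel_I \<nu> t) sequentially"
  unfolding bessel_I_eq_suminf
proof -
  obtain M where M: "0 \<le> M" and evM:
    "\<forall>\<^sub>F k in sequentially. \<forall>\<nu>\<in>cball (0::complex) R. norm (rGamma (of_nat k + \<nu> + 1)) \<le> M"
    using rGamma_shift_bounded .
  have "compact ((\<lambda>\<nu>. (t / 2) powr \<nu>) ` cball 0 R)"
    using assms by (intro compact_continuous_image holomorphic_on_imp_continuous_on holomorphic_intros) auto
  then obtain P where P: "\<And>\<nu>. \<nu> \<in> cball 0 R \<Longrightarrow> norm ((t / 2) powr \<nu>) \<le> P"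
    by (meson compact_imp_bounded bounded_iff image_eqI)
  define w where "w = (t / 2)\<^sup>2"
  define B where "B = (\<lambda>k. M * P * (inverse (fact k) * norm w ^ k))"
  have summ: "summable B"
    unfolding B_def by (intro summable_mult summable_exp)
  have "\<forall>\<^sub>F k in sequentially. \<forall>\<nu>\<in>cball 0 R. norm (bessel_I_term \<nu> t k) \<le> B k"
    using evM
  proof eventually_elim
    case (elim k)
    show ?case
    proof
      fix \<nu> :: complex assume \<nu>: "\<nu> \<in> cball 0 R"
      have "norm (bessel_I_term \<nu> t k) =
          (norm (rGamma (of_nat k + \<nu> + 1)) * norm ((t / 2) powr \<nu>)) *
          (inverse (fact k) * norm w ^ k)"
        unfolding bessel_I_term_eq[OF assms] power_mult w_def[symmetric]
        by (simp add: norm_mult norm_divide norm_power field_simps)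
      also have "\<dots> \<le> B k"
        unfolding B_def using elim \<nu> P[OF \<nu>] M
        by (intro mult_right_mono mult_mono) auto
      finally show "norm (bessel_I_term \<nu> t k) \<le> B k" .
    qed
  qed
  then show "uniform_limit (cball 0 R) (\<lambda>n \<nu>. \<Sum>k<n. bessel_I_term \<nu> t k)
      (\<lambda>\<nu>. suminf (bessel_I_term \<nu> t)) sequentially"
    using summ by (rule Weierstrass_m_test_ev)
qed

lemma bessel_I_sums:
  assumes "t \<noteq> 0"
  shows "bessel_I_term \<nu> t sums bessel_I \<nu> t"
  unfolding sums_def
  by (rule tendsto_uniform_limitI[OF uniform_limit_bessel_I[OF assms, of "norm \<nu>"]]) simp

lemma holomorphic_bessel_I:
  assumes "t \<noteq> 0"
  shows "(\<lambda>\<nu>. bessel_I \<nu> t) holomorphic_on A"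
proof -
  have "(\<lambda>\<nu>. bessel_I \<nu> t) holomorphic_on UNIV"
  proof (rule holomorphic_uniform_sequence)
    show "(\<lambda>\<nu>. \<Sum>k<n. bessel_I_term \<nu> t k) holomorphic_on UNIV" for n
      unfolding bessel_I_term_eq[OF assms] using assms
      by (intro holomorphic_intros) auto
    show "\<exists>d>0. cball z d \<subseteq> UNIV \<and> uniform_limit (cball z d)
        (\<lambda>n \<nu>. \<Sum>k<n. bessel_I_term \<nu> t k) (\<lambda>\<nu>. bessel_I \<nu> t) sequentially" for z
    proof (intro exI[of _ 1] conjI)
      show "uniform_limit (cball z 1) (\<lambda>n \<nu>. \<Sum>k<n. bessel_I_term \<nu> t k)
          (\<lambda>\<nu>. bessel_I \<nu> t) sequentially"
        by (rule uniform_limit_on_subset[OF uniform_limit_bessel_I[OF assms, of "norm z + 1"]])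
          (auto simp: subset_iff dist_norm intro: order_trans[OF norm_triangle_sub[of _ z]]
             simp: norm_minus_commute)
    qed auto
  qed auto
  then show ?thesis by (rule holomorphic_on_subset) auto
qed

section \<open>Symmetry at integer orders and the order recurrence of
  \<open>bessel_I\<close>\<close>

text \<open>At order \<open>- n\<close> the first \<open>n\<close> terms vanish, since
  \<open>rGamma\<close> is zero at the nonpositive integers; the remaining ones, shifted by
  \<open>n\<close>, are the terms of order \<open>n\<close>.\<close>

lemma bessel_I_minus_of_nat:
  assumes "t \<noteq> 0"
  shows "bessel_I (- of_nat n) t = bessel_I (of_nat n) t"
proof -
  have "bessel_I_term (- of_nat n) t i = 0" if "i < n" for i
  proof -
    have "of_nat i + - of_nat n + 1 = (of_int (int i - int n + 1) :: complex)"
      by simp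
    then have "rGamma (of_nat i + - of_nat n + 1 :: complex) = 0"
      using that by (simp only: rGamma_of_int) simp
    then show ?thesis by (simp add: bessel_I_term_def)
  qed
  moreover have "bessel_I_term (- of_nat n) t (i + n) = bessel_I_term (of_nat n) t i" for i
  proof -
    have "rGamma (of_nat (i + n) + - of_nat n + 1 :: complex) = inverse (fact i)"
      using rGamma_of_int[of "int i + 1", where ?'a = complex] by simp
    moreover have "rGamma (of_nat i + of_nat n + 1 :: complex) = inverse (fact (i + n))"
      using rGamma_of_int[of "int i + int n + 1", where ?'a = complex] by (simp add: nat_int_add)
    moreover have "2 * of_nat (i + n) + - of_nat n = (2 * of_nat i + of_nat n :: complex)"
      by simp
    ultimately show ?thesis
      unfolding bessel_I_term_def by (simp only:) (simp add: field_simps)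
  qed
  ultimately have "bessel_I_term (of_nat n) t sums bessel_I (- of_nat n) t"
    using sums_zero_iff_shift[of n "bessel_I_term (- of_nat n) t"]
      bessel_I_sums[OF assms, of "- of_nat n"] by simp
  then show ?thesis
    using bessel_I_sums[OF assms] sums_unique2 by blast
qed

lemma bessel_I_minus_Ints:
  assumes "t \<noteq> 0" "\<nu> \<in> \<int>"
  shows "bessel_I (- \<nu>) t = bessel_I \<nu> t"
proof -
  obtain n where n: "\<nu> = of_int n"
    using assms(2) Ints_cases by blast
  show ?thesis
  proof (cases n rule: int_cases2)
    case (nonneg k)
    then show ?thesis using n bessel_I_minus_of_nat[OF assms(1), of k] by simp
  next
    case (nonpos k)
    then show ?thesis using n bessel_I_minus_of_nat[OF assms(1), of k] by simp
  qed
qed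

lemma bessel_I_recurrence:
  assumes "t \<noteq> 0"
  shows "bessel_I (\<nu> - 1) t - bessel_I (\<nu> + 1) t = 2 * \<nu> / t * bessel_I \<nu> t"
proof -
  define s where "s = t / 2"
  have s: "s \<noteq> 0" using assms by (simp add: s_def)
  have minus: "s powr (\<nu> - 1) = s powr \<nu> / s"
    using s by (simp add: powr_def diff_divide_distrib left_diff_distrib exp_diff)
  have plus: "s powr (\<nu> + 1) = s powr \<nu> * s"
    using s by (simp add: powr_def ring_distribs exp_add)
  \<comment> \<open>The functional equation of \<open>rGamma\<close> reduces \<open>g k\<close> to
    \<open>k\<close> times the term of order \<open>\<nu>\<close>. So \<open>g 0\<close> vanishes,
    and for larger indices the factor cancels against the factorial, leaving the series of order
    \<open>\<nu> + 1\<close> shifted by one.\<close>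
  define g where "g = (\<lambda>k. s * bessel_I_term (\<nu> - 1) t k - \<nu> * bessel_I_term \<nu> t k)"
  have "g sums (s * bessel_I (\<nu> - 1) t - \<nu> * bessel_I \<nu> t)"
    unfolding g_def by (intro sums_diff sums_mult bessel_I_sums assms)
  moreover have gk: "g k = of_nat k * bessel_I_term \<nu> t k" for k
  proof -
    have "rGamma (of_nat k + (\<nu> - 1) + 1) = (of_nat k + \<nu>) * rGamma (of_nat k + \<nu> + 1)"
      using rGamma_plus1[of "of_nat k + \<nu>"] by simp
    then show ?thesis
      using s unfolding g_def bessel_I_term_eq[OF assms] s_def[symmetric] minus
      by (simp add: field_simps)
  qed
  moreover have "g (Suc k) = s * bessel_I_term (\<nu> + 1) t k" for k
    unfolding gk bessel_I_term_eq[OF assms] s_def[symmetric] plus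
    using s of_nat_neq_0[of k, where ?'a = complex]
    by (simp add: divide_simps add_ac)
  then have "(\<lambda>k. g (Suc k)) sums (s * bessel_I (\<nu> + 1) t)"
    by (simp add: sums_mult bessel_I_sums assms)
  then have "g sums (s * bessel_I (\<nu> + 1) t + g 0)"
    by (simp only: sums_Suc_iff)
  moreover have "g 0 = 0" by (simp add: gk)
  ultimately have "s * bessel_I (\<nu> - 1) t - \<nu> * bessel_I \<nu> t = s * bessel_I (\<nu> + 1) t"
    using sums_unique2 by fastforce
  then have "bessel_I (\<nu> - 1) t - bessel_I (\<nu> + 1) t = \<nu> / s * bessel_I \<nu> t"
    using s by (simp add: field_simps)
  then show ?thesis by (simp add: s_def)
qed

section \<open>Removing the singularities of the quotient at integer orders\<close>

text \<open>The complement is an open neighbourhood of \<open>z\<close> containing no integer other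
  than possibly \<open>z\<close>.\<close>

lemma closed_Ints_minus_singleton: "closed (\<int> - {z :: 'a::real_normed_algebra_1})"
proof -
  have "\<int> - {z} = of_int ` {n. of_int n \<noteq> z}"
    by (auto elim!: Ints_cases)
  then show ?thesis by (simp add: closed_of_int_image)
qed

lemma eventually_at_not_Ints: "\<forall>\<^sub>F \<mu> in at (\<nu>::complex). \<mu> \<notin> \<int>"
proof -
  have "open (- (\<int> - {\<nu>}))"
    using closed_Ints_minus_singleton by (rule open_Compl)
  then show ?thesis
    unfolding eventually_at_topological by (intro exI[of _ "- (\<int> - {\<nu>})"]) auto
qed

text \<open>Carries over to integer orders the identities that the quotient formula yields directly
  only elsewhere.\<close>

lemma isCont_eq_off_Ints:
  fixes f g :: "complex \<Rightarrow> complex"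
  assumes "isCont f \<nu>" "isCont g \<nu>" "\<And>\<mu>. \<mu> \<notin> \<int> \<Longrightarrow> f \<mu> = g \<mu>"
  shows "f \<nu> = g \<nu>"
proof (rule tendsto_unique)
  show "(f \<longlongrightarrow> f \<nu>) (at \<nu>)" using assms(1) by (simp add: isCont_def)
  show "(f \<longlongrightarrow> g \<nu>) (at \<nu>)"
  proof (rule Lim_transform_eventually)
    show "(g \<longlongrightarrow> g \<nu>) (at \<nu>)" using assms(2) by (simp add: isCont_def)
    show "\<forall>\<^sub>F \<mu> in at \<nu>. g \<mu> = f \<mu>"
      using eventually_at_not_Ints by eventually_elim (simp add: assms(3))
  qed
qed simp

lemma sin_pi_eq_0_iff: "sin (of_real pi * \<nu>) = 0 \<longleftrightarrow> \<nu> \<in> \<int>" for \<nu> :: complex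
proof
  assume "sin (of_real pi * \<nu>) = 0"
  then obtain n :: int where "of_real pi * \<nu> = of_real pi * of_int n"
    by (auto simp: sin_eq_0 mult.commute)
  then show "\<nu> \<in> \<int>" by simp
next
  assume "\<nu> \<in> \<int>"
  then obtain n :: int where "\<nu> = of_int n" by (auto elim: Ints_cases)
  then show "sin (of_real pi * \<nu>) = 0"
    by (auto simp: sin_eq_0 mult.commute intro!: exI[of _ n])
qed

text \<open>The \<open>Lim\<close> in the definition is informative only once a limit is known to
  exist. At an integer order numerator and sine both vanish and the zero of the sine is simple, so
  the quotient converges by comparing derivatives.\<close>

lemma bessel_K_quotient_tendsto:
  assumes "t \<noteq> 0"
  shows "((\<lambda>\<mu>. bessel_K_quotient \<mu> t) \<longlongrightarrow> bessel_K \<nu> t) (at \<nu>)"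
proof (cases "\<nu> \<in> \<int>")
  case False
  have "isCont (\<lambda>\<mu>. bessel_I \<mu> t) z" for z
    using holomorphic_on_imp_continuous_on[OF holomorphic_bessel_I[OF assms, of UNIV]]
    by (simp add: continuous_on_eq_continuous_at)
  then have "isCont (\<lambda>\<mu>. bessel_K_quotient \<mu> t) \<nu>"
    unfolding bessel_K_quotient_def using False
    by (intro continuous_intros isCont_o2[where g = "\<lambda>\<mu>. bessel_I \<mu> t" and f = uminus])
      (auto simp: sin_pi_eq_0_iff)
  then show ?thesis using False by (simp add: isCont_def bessel_K_def)
next
  case True
  define N where "N = (\<lambda>\<mu>. bessel_I (- \<mu>) t - bessel_I \<mu> t)"
  have "(\<lambda>\<mu>. bessel_I (- \<mu>) t) holomorphic_on UNIV"
    using holomorphic_on_compose[of uminus UNIV "\<lambda>\<mu>. bessel_I \<mu> t"] holomorphic_bessel_I[OF assms]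
    by (simp add: o_def holomorphic_intros)
  then have "N holomorphic_on UNIV"
    unfolding N_def using holomorphic_bessel_I[OF assms] by (intro holomorphic_intros)
  then have DN: "(N has_field_derivative deriv N \<nu>) (at \<nu>)"
    by (intro holomorphic_derivI[of _ UNIV]) auto
  have N0: "N \<nu> = 0" using bessel_I_minus_Ints[OF assms True] by (simp add: N_def)
  have DS: "((\<lambda>\<mu>. sin (of_real pi * \<mu>)) has_field_derivative of_real pi * cos (of_real pi * \<nu>)) (at \<nu>)"
    by (auto intro!: derivative_eq_intros)
  have S0: "sin (of_real pi * \<nu>) = 0" using True by (simp add: sin_pi_eq_0_iff)
  then have "cos (of_real pi * \<nu>) \<noteq> 0"
    using sin_cos_squared_add[of "of_real pi * \<nu>"] by auto
  then have "((\<lambda>\<mu>. ((N \<mu> - N \<nu>) / (\<mu> - \<nu>)) / ((sin (of_real pi * \<mu>) - sin (of_real pi * \<nu>)) / (\<mu> - \<nu>)))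
      \<longlongrightarrow> deriv N \<nu> / (of_real pi * cos (of_real pi * \<nu>))) (at \<nu>)"
    using DN DS by (intro tendsto_divide) (auto simp: has_field_derivative_iff)
  \<comment> \<open>Both subtracted values are 0, and \<open>\<mu> - \<nu>\<close> cancels away from
    \<open>\<nu>\<close>.\<close>
  then have "((\<lambda>\<mu>. N \<mu> / sin (of_real pi * \<mu>)) \<longlongrightarrow> deriv N \<nu> / (of_real pi * cos (of_real pi * \<nu>))) (at \<nu>)"
    by (rule Lim_transform_eventually) (auto simp: eventually_at_filter N0 S0)
  then have "\<exists>l. ((\<lambda>\<mu>. bessel_K_quotient \<mu> t) \<longlongrightarrow> l) (at \<nu>)"
    unfolding bessel_K_quotient_def N_def by (intro exI) (rule tendsto_mult_left)
  then show ?thesis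
    using True tendsto_Lim[of "at \<nu>"] by (auto simp: bessel_K_def)
qed

lemma isCont_bessel_K:
  assumes "t \<noteq> 0"
  shows "isCont (\<lambda>\<nu>. bessel_K \<nu> t) \<nu>"
  unfolding isCont_def
proof (rule Lim_transform_eventually)
  show "((\<lambda>\<mu>. bessel_K_quotient \<mu> t) \<longlongrightarrow> bessel_K \<nu> t) (at \<nu>)"
    by (rule bessel_K_quotient_tendsto[OF assms])
  show "\<forall>\<^sub>F \<mu> in at \<nu>. bessel_K_quotient \<mu> t = bessel_K \<mu> t"
    using eventually_at_not_Ints by eventually_elim (simp add: bessel_K_def)
qed

text \<open>Near \<open>\<nu>\<close>, with \<open>\<nu>\<close> itself removed, the function agrees
  with the holomorphic quotient; continuity at \<open>\<nu>\<close> makes the singularity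
  removable.\<close>

lemma field_differentiable_bessel_K:
  assumes "t \<noteq> 0"
  shows "(\<lambda>\<nu>. bessel_K \<nu> t) field_differentiable (at \<nu>)"
proof -
  define U where "U = - (\<int> - {\<nu>})"
  have "open U"
    unfolding U_def using closed_Ints_minus_singleton by (rule open_Compl)
  have "(\<lambda>\<mu>. bessel_I (- \<mu>) t) holomorphic_on (U - {\<nu>})"
    using holomorphic_on_compose[of uminus "U - {\<nu>}" "\<lambda>\<mu>. bessel_I \<mu> t"] holomorphic_bessel_I[OF assms]
    by (simp add: o_def holomorphic_intros)
  then have "(\<lambda>\<mu>. bessel_K_quotient \<mu> t) holomorphic_on (U - {\<nu>})"
    unfolding bessel_K_quotient_def using holomorphic_bessel_I[OF assms]
    by (intro holomorphic_intros) (auto simp: U_def sin_pi_eq_0_iff)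
  then have "(\<lambda>\<mu>. bessel_K \<mu> t) holomorphic_on (U - {\<nu>})"
    by (rule holomorphic_transform) (auto simp: U_def bessel_K_def)
  moreover have "continuous_on U (\<lambda>\<mu>. bessel_K \<mu> t)"
    using isCont_bessel_K[OF assms] by (simp add: continuous_at_imp_continuous_on)
  ultimately have "(\<lambda>\<mu>. bessel_K \<mu> t) holomorphic_on U"
    using no_isolated_singularity[of U "\<lambda>\<mu>. bessel_K \<mu> t" "{\<nu>}"] \<open>open U\<close> by simp
  then show ?thesis
    using \<open>open U\<close> by (rule holomorphic_on_imp_differentiable_at) (simp add: U_def)
qed

lemma has_field_derivative_bessel_K:
  assumes "t \<noteq> 0"
  shows "((\<lambda>\<nu>. bessel_K \<nu> t) has_field_derivative deriv (\<lambda>\<nu>. bessel_K \<nu> t) \<nu>) (at \<nu>)"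
  using field_differentiable_bessel_K[OF assms] by (simp add: DERIV_deriv_iff_field_differentiable)

section \<open>Symmetry and recurrence of \<open>bessel_K\<close> in the order, and their
  derivatives\<close>

text \<open>Off the integers the numerator and the sine are both odd in the order; continuity covers
  the integers.\<close>

lemma bessel_K_minus:
  assumes "t \<noteq> 0"
  shows "bessel_K (- \<nu>) t = bessel_K \<nu> t"
proof (rule isCont_eq_off_Ints[where f = "\<lambda>\<nu>. bessel_K (- \<nu>) t"])
  show "isCont (\<lambda>\<nu>. bessel_K (- \<nu>) t) \<nu>"
    by (intro isCont_o2[where g = "\<lambda>\<mu>. bessel_K \<mu> t" and f = uminus] isCont_bessel_K[OF assms])
      (intro continuous_intros)
  show "isCont (\<lambda>\<nu>. bessel_K \<nu> t) \<nu>" by (rule isCont_bessel_K[OF assms])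
  show "bessel_K (- \<mu>) t = bessel_K \<mu> t" if "\<mu> \<notin> \<int>" for \<mu>
    using that minus_divide_left[of "bessel_I \<mu> t - bessel_I (- \<mu>) t" "sin (of_real pi * \<mu>)"]
    by (simp add: bessel_K_def bessel_K_quotient_def)
qed

lemma bessel_K_recurrence:
  assumes "t \<noteq> 0"
  shows "bessel_K (\<nu> + 1) t = bessel_K (\<nu> - 1) t + 2 * \<nu> / t * bessel_K \<nu> t"
proof (rule isCont_eq_off_Ints[where f = "\<lambda>\<nu>. bessel_K (\<nu> + 1) t"])
  have cont: "isCont (\<lambda>\<nu>. bessel_K (\<nu> + c) t) \<nu>" for c
    by (intro isCont_o2[where g = "\<lambda>\<mu>. bessel_K \<mu> t" and f = "\<lambda>\<nu>. \<nu> + c"] isCont_bessel_K[OF assms])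
      (intro continuous_intros)
  show "isCont (\<lambda>\<nu>. bessel_K (\<nu> + 1) t) \<nu>" by (rule cont)
  show "isCont (\<lambda>\<nu>. bessel_K (\<nu> - 1) t + 2 * \<nu> / t * bessel_K \<nu> t) \<nu>"
    using cont[of "- 1"] assms by (intro continuous_intros isCont_bessel_K) auto
  show "bessel_K (\<mu> + 1) t = bessel_K (\<mu> - 1) t + 2 * \<mu> / t * bessel_K \<mu> t" if \<mu>: "\<mu> \<notin> \<int>" for \<mu>
  proof -
    \<comment> \<open>A shift by one preserves non-integrality, so all three orders are governed by
      the quotient formula.\<close>
    have "\<mu> + 1 \<notin> \<int>" "\<mu> - 1 \<notin> \<int>"
      using \<mu> Ints_diff[of "\<mu> + 1" 1] Ints_add[of "\<mu> - 1" 1] by auto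
    moreover have "sin (of_real pi * (\<mu> + 1)) = - sin (of_real pi * \<mu>)"
      "sin (of_real pi * (\<mu> - 1)) = - sin (of_real pi * \<mu>)"
      by (simp_all add: ring_distribs sin_add sin_diff flip: sin_of_real cos_of_real)
    \<comment> \<open>At order \<open>- \<mu>\<close> raising and lowering trade places, so the
      negated orders obey the same relation as the orders themselves. The sign flip of the sine then
      turns its minus into a plus.\<close>
    moreover have "bessel_I (- (\<mu> + 1)) t = bessel_I (- (\<mu> - 1)) t - 2 * \<mu> / t * bessel_I (- \<mu>) t"
    proof -
      have "- (\<mu> + 1) = - \<mu> - 1" "- (\<mu> - 1) = - \<mu> + 1" by simp_all
      then show ?thesis
        using bessel_I_recurrence[OF assms, of "- \<mu>"] by (simp only:) (simp add: diff_eq_eq)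
    qed
    moreover have "bessel_I (\<mu> + 1) t = bessel_I (\<mu> - 1) t - 2 * \<mu> / t * bessel_I \<mu> t"
      using bessel_I_recurrence[OF assms, of \<mu>] by (simp add: algebra_simps)
    moreover have "sin (of_real pi * \<mu>) \<noteq> 0"
      using \<mu> by (simp add: sin_pi_eq_0_iff)
    ultimately show ?thesis
      unfolding bessel_K_def bessel_K_quotient_def using \<mu> assms
      by (simp only: if_False) (simp add: divide_simps, simp add: algebra_simps)
  qed
qed

lemma deriv_bessel_K_minus:
  assumes "t \<noteq> 0"
  shows "deriv (\<lambda>\<nu>. bessel_K \<nu> t) (- \<nu>) = - deriv (\<lambda>\<nu>. bessel_K \<nu> t) \<nu>"
proof -
  have "((\<lambda>\<nu>. bessel_K (- \<nu>) t) has_field_derivative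
      deriv (\<lambda>\<nu>. bessel_K \<nu> t) (- \<nu>) * (- 1)) (at \<nu>)"
    by (rule DERIV_chain2[OF has_field_derivative_bessel_K[OF assms]])
      (auto intro!: derivative_eq_intros)
  then show ?thesis
    using has_field_derivative_bessel_K[OF assms, of \<nu>]
    by (auto simp: bessel_K_minus[OF assms] dest: DERIV_unique)
qed

text \<open>Differentiating the coefficient \<open>2 * \<nu> / t\<close> produces the inhomogeneous
  term, the source of the finite sum.\<close>

lemma deriv_bessel_K_recurrence:
  assumes "t \<noteq> 0"
  shows "deriv (\<lambda>\<nu>. bessel_K \<nu> t) (\<nu> + 1) =
    deriv (\<lambda>\<nu>. bessel_K \<nu> t) (\<nu> - 1) + 2 * \<nu> / t * deriv (\<lambda>\<nu>. bessel_K \<nu> t) \<nu> + 2 / t * bessel_K \<nu> t"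
proof -
  let ?K = "\<lambda>\<nu>. bessel_K \<nu> t"
  have shift: "((\<lambda>\<nu>. ?K (\<nu> + c)) has_field_derivative deriv ?K (\<nu> + c)) (at \<nu>)" for c
    using has_field_derivative_bessel_K[OF assms, of "\<nu> + c"] by (simp add: DERIV_shift)
  have "((\<lambda>\<nu>. ?K (\<nu> - 1) + 2 * \<nu> / t * ?K \<nu>) has_field_derivative
      deriv ?K (\<nu> - 1) + (2 / t * ?K \<nu> + deriv ?K \<nu> * (2 * \<nu> / t))) (at \<nu>)"
    using shift[of "- 1"] assms
    by (intro DERIV_add DERIV_mult has_field_derivative_bessel_K)
      (auto intro!: derivative_eq_intros)
  then have "((\<lambda>\<nu>. ?K (\<nu> + 1)) has_field_derivative
      deriv ?K (\<nu> - 1) + (2 / t * ?K \<nu> + deriv ?K \<nu> * (2 * \<nu> / t))) (at \<nu>)"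
    by (simp add: bessel_K_recurrence[OF assms])
  from DERIV_unique[OF shift[of 1] this] show ?thesis
    by (simp add: algebra_simps)
qed

section \<open>An algebraic recurrence for the finite sum\<close>

text \<open>
  With \<open>a k = K\<^sub>k(t) (t/2)^k / k!\<close> and \<open>q = (t/2)^2\<close>, the hypothesis is the recurrence of \<open>K\<close> in the
  order and \<open>B n\<close> is the sum in the theorem up to the factor \<open>n! / (2 (t/2)^n)\<close>.
\<close>
lemma sum_divide_diff_recurrence:
  fixes a :: "nat \<Rightarrow> 'a::field_char_0"
  defines "B \<equiv> \<lambda>n. \<Sum>k<n. a k / of_nat (n - k)"
  assumes rec: "\<And>k. of_nat (k + 2) * a (k + 2) = of_nat (k + 1) * a (k + 1) + q * a k / of_nat (k + 1)"
  shows "of_nat (n + 2) * B (n + 2) =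
    q / of_nat (n + 1) * B n + of_nat (n + 1) * B (n + 1) + 2 * a (n + 1)"
proof -
  define S where "S = (\<lambda>n. \<Sum>k<n. of_nat k * a k / of_nat (n - k))"
  \<comment> \<open>Writing \<open>m = (m - k) + k\<close> separates a plain partial sum from
    \<open>S\<close>.\<close>
  have split: "of_nat m * B m = (\<Sum>k<m. a k) + S m" for m
  proof -
    have "of_nat m * (a k / of_nat (m - k)) = a k + of_nat k * a k / of_nat (m - k)" if "k < m" for k
      using that by (simp add: of_nat_diff field_simps)
    then show ?thesis
      unfolding B_def S_def by (simp add: sum_distrib_left flip: sum.distrib)
  qed
  \<comment> \<open>The hypothesis gives the increments of \<open>of_nat k * a k\<close>.\<close>
  have telescope: "of_nat (n + 1) * a (n + 1) = a 1 + q * (\<Sum>i<n. a i / of_nat (i + 1))" for n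
  proof (induction n)
    case (Suc n)
    then show ?case using rec[of n] by (simp add: distrib_left)
  qed simp
  \<comment> \<open>The summand of \<open>S\<close> at 0 vanishes. Shifting by one here and by two
    in \<open>S2\<close> gives both sums the denominators \<open>n - i\<close>, so that their
    difference can be formed termwise.\<close>
  have S1: "S (n + 1) = (\<Sum>i<n. of_nat (i + 1) * a (i + 1) / of_nat (n - i))"
    unfolding S_def by (simp add: sum.lessThan_Suc_shift del: sum.lessThan_Suc of_nat_Suc of_nat_diff)
  have S2: "S (n + 2) = a 1 / of_nat (n + 1) + (\<Sum>i<n. of_nat (i + 2) * a (i + 2) / of_nat (n - i))"
    unfolding S_def by (simp add: sum.lessThan_Suc_shift numeral_2_eq_2 del: sum.lessThan_Suc of_nat_Suc of_nat_diff)
  \<comment> \<open>The hypothesis leaves \<open>q * a i\<close> over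
    \<open>(i + 1) * (n - i)\<close>. These two factors add up to \<open>n + 1\<close>, which gives
    the partial fractions.\<close>
  have "(of_nat (i + 2) * a (i + 2) - of_nat (i + 1) * a (i + 1)) / of_nat (n - i) =
      q / of_nat (n + 1) * (a i / of_nat (n - i) + a i / of_nat (i + 1))" if "i < n" for i
  proof -
    define d where "d = n - i"
    have d: "n = i + d" "d > 0" using that by (simp_all add: d_def)
    have partial_fraction: "u / x / e = u / (x + e) * (1 / e + 1 / x)"
      if "x \<noteq> 0" "e \<noteq> 0" "x + e \<noteq> 0" for u x e :: 'a
      using that by (simp add: divide_simps)
    have "of_nat (n + 1) = of_nat (i + 1) + (of_nat d :: 'a)"
      by (simp add: d)
    moreover have "of_nat (i + 1) + of_nat d \<noteq> (0 :: 'a)" "of_nat (i + 1) \<noteq> (0 :: 'a)"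
      using of_nat_eq_0_iff[of "i + 1 + d", where ?'a = 'a] of_nat_eq_0_iff[of "i + 1", where ?'a = 'a]
      by (simp_all only: of_nat_add)
    moreover have "n - i = d" "of_nat d \<noteq> (0 :: 'a)"
      using d by simp_all
    ultimately show ?thesis
      unfolding rec using partial_fraction[of "of_nat (i + 1)" "of_nat d" "q * a i"]
      by (simp add: distrib_left mult.assoc add_ac del: of_nat_add)
  qed
  then have "(\<Sum>i<n. of_nat (i + 2) * a (i + 2) / of_nat (n - i)) -
      (\<Sum>i<n. of_nat (i + 1) * a (i + 1) / of_nat (n - i)) =
      q / of_nat (n + 1) * (B n + (\<Sum>i<n. a i / of_nat (i + 1)))"
    unfolding B_def by (simp add: diff_divide_distrib sum_distrib_left flip: sum.distrib sum_subtractf)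
  then have "S (n + 2) - S (n + 1) =
      q / of_nat (n + 1) * B n + (a 1 + q * (\<Sum>i<n. a i / of_nat (i + 1))) / of_nat (n + 1)"
    unfolding S1 S2 by (simp add: add_divide_distrib distrib_left del: of_nat_add of_nat_Suc)
  also have "\<dots> = q / of_nat (n + 1) * B n + a (n + 1)"
    unfolding telescope[symmetric] by (simp del: of_nat_add of_nat_Suc)
  \<comment> \<open>One copy of \<open>a (n + 1)\<close> comes from the difference of the
    \<open>S\<close> values, the other from the last summand of the plain partial sum in
    \<open>split\<close>.\<close>
  finally show ?thesis
    unfolding split by (simp add: numeral_2_eq_2 algebra_simps)
qed

section \<open>The closed form, its recurrence and the induction on the order\<close>

definition bessel_K_order_deriv :: "complex \<Rightarrow> nat \<Rightarrow> complex" where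
  "bessel_K_order_deriv t m = fact m / 2 * (\<Sum>k<m. bessel_K (of_nat k) t / (fact k * of_nat (m - k))
                                    * (t / 2) powi (int k - int m))"

text \<open>Pulling out \<open>fact m / (2 * s ^ m)\<close> leaves the sum \<open>B\<close>, to
  which \<open>sum_divide_diff_recurrence\<close> applies with the square of \<open>s\<close> for
  \<open>q\<close>. After rescaling, its term \<open>2 * a (n + 1)\<close> becomes the inhomogeneous
  term.\<close>

lemma bessel_K_order_deriv_recurrence:
  assumes "t \<noteq> 0"
  shows "bessel_K_order_deriv t (n + 2) = bessel_K_order_deriv t n
    + 2 * of_nat (n + 1) / t * bessel_K_order_deriv t (n + 1) + 2 / t * bessel_K (of_nat (n + 1)) t"
proof -
  define s where "s = t / 2"
  have s: "s \<noteq> 0" and t: "t = 2 * s" using assms by (simp_all add: s_def)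
  define a where "a = (\<lambda>k. bessel_K (of_nat k) t * s ^ k / fact k)"
  define B where "B = (\<lambda>n. \<Sum>k<n. a k / of_nat (n - k))"
  have D: "bessel_K_order_deriv t m = fact m / (2 * s ^ m) * B m" for m
    unfolding bessel_K_order_deriv_def B_def a_def s_def[symmetric] sum_distrib_left
    using s by (intro sum.cong) (auto simp: power_int_diff field_simps)
  have nz: "(of_nat k :: complex) + 1 \<noteq> 0" "(of_nat k :: complex) + 2 \<noteq> 0" for k
    using of_nat_neq_0[of k, where ?'a = complex] of_nat_neq_0[of "Suc k", where ?'a = complex]
    by (simp_all add: add_ac)
  have expand: "fact (n + 2) = (of_nat n + 2) * (of_nat n + 1) * (fact n :: complex)"
    "fact (n + 1) = (of_nat n + 1) * (fact n :: complex)"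
    "s ^ (n + 2) = s ^ n * s\<^sup>2" "s ^ (n + 1) = s ^ n * s"
    "of_nat (n + 2) = (of_nat n + 2 :: complex)" "of_nat (n + 1) = (of_nat n + 1 :: complex)"
    "2 * (of_nat n + 1) / t = (of_nat n + 1) / s"  "2 / t * x = x / s" for n x
    by (simp_all add: power_add algebra_simps power2_eq_square t divide_simps)
  have "of_nat (k + 2) * a (k + 2) = of_nat (k + 1) * a (k + 1) + s\<^sup>2 * a k / of_nat (k + 1)" for k
  proof -
    have "bessel_K (of_nat (k + 2)) t = bessel_K (of_nat k) t + of_nat (k + 1) / s * bessel_K (of_nat (k + 1)) t"
    proof -
      have "of_nat (k + 1) + 1 = (of_nat (k + 2) :: complex)" "of_nat (k + 1) - 1 = (of_nat k :: complex)"
        "2 * of_nat (k + 1) / t = of_nat (k + 1) / s"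
        using s by (simp_all add: t field_simps)
      with bessel_K_recurrence[OF assms, of "of_nat (k + 1)"] show ?thesis by (simp only:)
    qed
    moreover have "(x + 2) * ((b + (x + 1) / s * c) * (p * s\<^sup>2) / ((x + 2) * (x + 1) * F)) =
        (x + 1) * (c * (p * s) / ((x + 1) * F)) + s\<^sup>2 * (b * p / F) / (x + 1)"
      if "x + 1 \<noteq> 0" "x + 2 \<noteq> 0" "F \<noteq> 0" for x F p b c
    proof -
      \<comment> \<open>The identity holds with \<open>x + 1\<close> and \<open>x + 2\<close> as
        independent atoms; folding them keeps the simplifier from expanding the
        denominators.\<close>
      define y z where "y = x + 1" and "z = x + 2"
      then show ?thesis
        using that s unfolding y_def[symmetric] z_def[symmetric]
        by (simp add: field_simps power2_eq_square)
    qed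
    ultimately show ?thesis
      unfolding a_def expand using nz[of k] by simp
  qed
  then have "of_nat (n + 2) * B (n + 2) =
      s\<^sup>2 / of_nat (n + 1) * B n + of_nat (n + 1) * B (n + 1) + 2 * a (n + 1)"
    unfolding B_def by (rule sum_divide_diff_recurrence)
  then have B: "B (n + 2) = (s\<^sup>2 / of_nat (n + 1) * B n + of_nat (n + 1) * B (n + 1) + 2 * a (n + 1)) / of_nat (n + 2)"
    using of_nat_eq_0_iff[of "n + 2", where ?'a = complex]
    by (metis add_is_0 nonzero_mult_div_cancel_left zero_neq_numeral)
  have alg: "(x + 2) * (x + 1) * F / (2 * (p * s\<^sup>2)) *
        ((s\<^sup>2 / (x + 1) * b0 + (x + 1) * b1 + 2 * (k * (p * s) / ((x + 1) * F))) / (x + 2)) =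
      F / (2 * p) * b0 + (x + 1) / s * ((x + 1) * F / (2 * (p * s)) * b1) + k / s"
    if "x + 1 \<noteq> 0" "x + 2 \<noteq> 0" "F \<noteq> 0" "p \<noteq> 0" for x F p b0 b1 k
  proof -
    define y z where "y = x + 1" and "z = x + 2"
    then show ?thesis
      using that s unfolding y_def[symmetric] z_def[symmetric]
      by (simp add: field_simps power2_eq_square)
  qed
  show ?thesis
    unfolding D B a_def expand by (rule alg[OF nz[of n]]) (use s in simp_all)
qed

text \<open>Oddness forces the derivative at 0 to vanish, matching the empty sum. The recurrence at
  order 0 relates the derivatives at 1 and -1, which are opposite, so it determines the value at 1.
  Beyond that both sides obey the same two-step recurrence.\<close>

lemma deriv_bessel_K_of_nat:
  assumes "t \<noteq> 0"
  shows "deriv (\<lambda>\<nu>. bessel_K \<nu> t) (of_nat m) = bessel_K_order_deriv t m"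
proof (induction m rule: induct_nat_012)
  case 0
  show ?case
    using deriv_bessel_K_minus[OF assms, of 0] by (simp add: bessel_K_order_deriv_def)
next
  case 1
  have "2 * deriv (\<lambda>\<nu>. bessel_K \<nu> t) 1 = 2 / t * bessel_K 0 t"
    using deriv_bessel_K_recurrence[OF assms, of 0] deriv_bessel_K_minus[OF assms, of 1] by simp
  then have "deriv (\<lambda>\<nu>. bessel_K \<nu> t) 1 = bessel_K 0 t / t"
    using assms by (simp add: field_simps)
  then show ?case
    by (simp add: bessel_K_order_deriv_def power_int_minus)
next
  case (ge2 n)
  have "deriv (\<lambda>\<nu>. bessel_K \<nu> t) (of_nat (n + 2)) = deriv (\<lambda>\<nu>. bessel_K \<nu> t) (of_nat n)
      + 2 * of_nat (n + 1) / t * deriv (\<lambda>\<nu>. bessel_K \<nu> t) (of_nat (n + 1))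
      + 2 / t * bessel_K (of_nat (n + 1)) t"
    using deriv_bessel_K_recurrence[OF assms, of "of_nat (n + 1)"] by (simp add: add_ac)
  then show ?case
    using ge2 bessel_K_order_deriv_recurrence[OF assms, of n] by (simp add: numeral_2_eq_2)
qed

theorem corollary3p13:
  fixes t :: complex and m :: nat
  assumes "t \<noteq> 0"
  shows "((\<lambda>\<nu>. bessel_K \<nu> t) has_field_derivative
            (fact m / 2 * (\<Sum>k<m. bessel_K (of_nat k) t / (fact k * of_nat (m - k))
                                    * (t / 2) powi (int k - int m)))) (at (of_nat m))
       \<and> ((\<lambda>\<nu>. bessel_K \<nu> t) has_field_derivative
            - (fact m / 2 * (\<Sum>k<m. bessel_K (of_nat k) t / (fact k * of_nat (m - k))
                                    * (t / 2) powi (int k - int m)))) (at (- of_nat m))"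
  using has_field_derivative_bessel_K[OF assms, of "of_nat m"]
    has_field_derivative_bessel_K[OF assms, of "- of_nat m"]
  unfolding deriv_bessel_K_minus[OF assms] deriv_bessel_K_of_nat[OF assms] bessel_K_order_deriv_def
  by blast

end
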